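(* Given the payoffs $R,S,T,P$ of the prisoner's dilemma, the payoff vector $\mathbf f_N$ of the alternating memory-$N$ game can be constructed recursively. Define $$\widetilde{\mathbf f}_1=\begin{pmatrix} R\\ S\\ T\\ P\end{pmatrix},\qquad \widetilde{\mathbf f}_N=\begin{pmatrix} \widetilde{\mathbf f}_{N-1}+R\,\mathbf 1_{N-1}\\ \widetilde{\mathbf f}_{N-1}+S\,\mathbf 1_{N-1}\\ \widetilde{\mathbf f}_{N-1}+T\,\mathbf 1_{N-1}\\ \widetilde{\mathbf f}_{N-1}+P\,\mathbf 1_{N-1}\end{pmatrix}\quad(N\ge2),$$ where $\mathbf 1_N$ is the $2^{2N}$-dimensional vector all of whose entries equal $1$. Then for all $N\ge1$ $$\mathbf f_N=\frac1N\,\widetilde{\mathbf f}_N.$$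
   Context: Game histories of $N$ rounds are words $i_1i_2\ldots i_{2N}$ over $\{C,D\}$, ordered lexicographically with $C$ before $D$, where $i_{2k-1}$ and $i_{2k}$ are the moves of the focal player and of the opponent in the $k$-th of the $N$ remembered rounds. The one-round payoff of the focal player is $R,S,T,P$ if the outcome $i_{2k-1}i_{2k}$ of the round is $CC,CD,DC,DD$ respectively. The payoff vector $\mathbf f_N\in\mathbb R^{2^{2N}}$ lists in lexicographic order the payoffs of the focal player for each history $i_1\ldots i_{2N}$, averaged over the $N$ rounds. *)

theory Defs
  imports "Jordan_Normal_Form.Matrix" "HOL-Library.List_Lexorder"
begin

datatype move = C | D

instantiation move :: linorder
begin

definition less_eq_move :: "move \<Rightarrow> move \<Rightarrow> bool" where
  "x \<le> y \<longleftrightarrow> x = C \<or> y = D"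

definition less_move :: "move \<Rightarrow> move \<Rightarrow> bool" where
  "x < y \<longleftrightarrow> x = C \<and> y = D"

instance
proof
  fix x y z :: move
  show "x < y \<longleftrightarrow> x \<le> y \<and> \<not> y \<le> x"
    by (cases x; cases y) (simp_all add: less_eq_move_def less_move_def)
  show "x \<le> x"
    by (cases x) (simp_all add: less_eq_move_def)
  show "x \<le> y \<Longrightarrow> y \<le> z \<Longrightarrow> x \<le> z"
    by (auto simp: less_eq_move_def)
  show "x \<le> y \<Longrightarrow> y \<le> x \<Longrightarrow> x = y"
    by (auto simp: less_eq_move_def)
  show "x \<le> y \<or> y \<le> x"
    by (cases x; cases y) (simp_all add: less_eq_move_def)
qed

end

text \<open>
  Lists of moves carry the lexicographic order of List_Lexorder, so the histories below are
  listed in lexicographic order with C before D.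
\<close>

definition histories :: "nat \<Rightarrow> move list list" where
  "histories N = sorted_list_of_set {w. length w = 2 * N}"

fun round_payoff :: "real \<Rightarrow> real \<Rightarrow> real \<Rightarrow> real \<Rightarrow> move \<Rightarrow> move \<Rightarrow> real" where
  "round_payoff R S T P C C = R"
| "round_payoff R S T P C D = S"
| "round_payoff R S T P D C = T"
| "round_payoff R S T P D D = P"

text \<open>
  List positions start at 0, so for a word \<open>i\<^sub>1 i\<^sub>2 \<dots>\<close> the letters \<open>i\<close> with indices
  \<open>2 * k - 1\<close> (focal player) and \<open>2 * k\<close> (opponent) are at positions \<open>2 * k - 2\<close> and
  \<open>2 * k - 1\<close>.
\<close>

definition average_payoff ::
  "real \<Rightarrow> real \<Rightarrow> real \<Rightarrow> real \<Rightarrow> nat \<Rightarrow> move list \<Rightarrow> real" where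
  "average_payoff R S T P N w =
     (\<Sum>k = 1..N. round_payoff R S T P (w ! (2 * k - 2)) (w ! (2 * k - 1))) / real N"

definition payoff_vec :: "real \<Rightarrow> real \<Rightarrow> real \<Rightarrow> real \<Rightarrow> nat \<Rightarrow> real vec" where
  "payoff_vec R S T P N = vec_of_list (map (average_payoff R S T P N) (histories N))"

definition ones_vec :: "nat \<Rightarrow> real vec" where
  "ones_vec N = vec (2 ^ (2 * N)) (\<lambda>_. 1)"

text \<open>The recursion starts at 1; the value at 0 is left unspecified.\<close>

fun payoff_tilde :: "real \<Rightarrow> real \<Rightarrow> real \<Rightarrow> real \<Rightarrow> nat \<Rightarrow> real vec" where
  "payoff_tilde R S T P (Suc 0) = vec_of_list [R, S, T, P]"
| "payoff_tilde R S T P (Suc (Suc n)) =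
     (payoff_tilde R S T P (Suc n) + R \<cdot>\<^sub>v ones_vec (Suc n)) @\<^sub>v
     ((payoff_tilde R S T P (Suc n) + S \<cdot>\<^sub>v ones_vec (Suc n)) @\<^sub>v
     ((payoff_tilde R S T P (Suc n) + T \<cdot>\<^sub>v ones_vec (Suc n)) @\<^sub>v
      (payoff_tilde R S T P (Suc n) + P \<cdot>\<^sub>v ones_vec (Suc n))))"

end

theory Submission imports Defs begin

text \<open>A history of N + 1 rounds is a first round followed by a history of N rounds. In
  lexicographic order the histories therefore form four consecutive blocks, with first round CC, CD,
  DC, DD, and each block runs through the shorter histories in their own order
  (\<open>histories_Suc\<close>). Within a block the first round adds the constant R, S, T or P to
  the total over the other rounds (\<open>total_payoff_Suc\<close>). So the vector of totals obeys
  the recursion of \<open>payoff_tilde\<close> (\<open>payoff_tilde_eq_total_payoff\<close>), and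
  dividing by N turns totals into averages.\<close>

text \<open>A strictly increasing list is determined by its set of entries. Prefixing a common
  letter preserves the order, and every word starting with \<open>C\<close> precedes every word
  starting with \<open>D\<close>.\<close>

lemma sorted_list_of_set_words_Suc:
  "sorted_list_of_set {w :: move list. length w = Suc n} =
     map ((#) C) (sorted_list_of_set {w. length w = n}) @
     map ((#) D) (sorted_list_of_set {w. length w = n})"
proof -
  let ?W = "{w :: move list. length w = n}"
  let ?s = "sorted_list_of_set ?W"
  \<comment> \<open>Finiteness is essential: \<open>sorted_list_of_set\<close> of an infinite set is
    the empty list.\<close>
  have "UNIV = {C, D}"
    using move.exhaust by blast
  then have "finite {w :: move list. set w \<subseteq> UNIV \<and> length w = m}" for m
    by (metis finite.emptyI finite.insertI finite_lists_length_eq)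
  then have fin: "finite {w :: move list. length w = m}" for m
    by simp
  have set: "set (map ((#) C) ?s @ map ((#) D) ?s) = {w. length w = Suc n}"
    using fin[of n] move.exhaust by (auto simp: length_Suc_conv image_iff)
  have "sorted_wrt (<) ?s"
    by simp
  then have "sorted_wrt (<) (map ((#) C) ?s @ map ((#) D) ?s)"
    by (auto simp: sorted_wrt_append sorted_wrt_map less_move_def)
  then have "sorted_list_of_set (set (map ((#) C) ?s @ map ((#) D) ?s)) =
      map ((#) C) ?s @ map ((#) D) ?s"
    using strict_sorted_iff sorted_list_of_set.idem_if_sorted_distinct by blast
  then show ?thesis
    unfolding set .
qed

lemma histories_0: "histories 0 = [[]]"
  by (simp add: histories_def)

lemma histories_Suc:
  "histories (Suc N) =
     map (\<lambda>w. C # C # w) (histories N) @ map (\<lambda>w. C # D # w) (histories N) @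
     map (\<lambda>w. D # C # w) (histories N) @ map (\<lambda>w. D # D # w) (histories N)"
  by (simp add: histories_def sorted_list_of_set_words_Suc comp_def)

lemma length_histories: "length (histories N) = 2 ^ (2 * N)"
  by (induction N) (simp_all add: histories_0 histories_Suc)

text \<open>The undivided numerator of \<open>average_payoff\<close>: totals grow by one summand per
  round, whereas averages would also have to be rescaled.\<close>

definition total_payoff ::
  "real \<Rightarrow> real \<Rightarrow> real \<Rightarrow> real \<Rightarrow> nat \<Rightarrow> move list \<Rightarrow> real" where
  "total_payoff R S T P N w =
     (\<Sum>k = 1..N. round_payoff R S T P (w ! (2 * k - 2)) (w ! (2 * k - 1)))"

lemma total_payoff_0: "total_payoff R S T P 0 w = 0"
  by (simp add: total_payoff_def)

lemma total_payoff_Suc: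
  "total_payoff R S T P (Suc N) (a # b # w) =
     total_payoff R S T P N w + round_payoff R S T P a b"
proof -
  let ?f = "\<lambda>v k. round_payoff R S T P (v ! (2 * k - 2)) (v ! (2 * k - 1))"
  \<comment> \<open>Dropping one round shifts positions by two. At k = 0 the truncated subtraction
    on the right would read wrong positions, hence the restriction.\<close>
  have "?f (a # b # w) (Suc k) = ?f w k" if "k \<ge> 1" for k
    using that by (cases k) simp_all
  then have "(\<Sum>k = 1..N. ?f (a # b # w) (Suc k)) = (\<Sum>k = 1..N. ?f w k)"
    by (intro sum.cong) simp_all
  then show ?thesis
    unfolding total_payoff_def
    \<comment> \<open>The first summand has to be split off; \<open>sum.cl_ivl_Suc\<close> would
      split off the last one.\<close>
    by (simp add: sum.atLeast_Suc_atMost sum.shift_bounds_cl_Suc_ivl del: sum.cl_ivl_Suc)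
qed

lemma vec_of_list_append: "vec_of_list (xs @ ys) = vec_of_list xs @\<^sub>v vec_of_list ys"
  by (rule eq_vecI) (auto simp: vec_of_list_index nth_append)

lemma vec_of_list_map_add_const:
  fixes f :: "'a \<Rightarrow> real"
  assumes "length xs = 2 ^ (2 * N)"
  shows "vec_of_list (map (\<lambda>x. f x + c) xs) = vec_of_list (map f xs) + c \<cdot>\<^sub>v ones_vec N"
  by (rule eq_vecI) (auto simp: vec_of_list_index ones_vec_def assms)

lemma payoff_tilde_eq_total_payoff:
  assumes "N \<ge> 1"
  shows "payoff_tilde R S T P N = vec_of_list (map (total_payoff R S T P N) (histories N))"
  using assms
proof (induction N rule: nat_induct_at_least)
  case base
  show ?case
    by (simp add: histories_0 histories_Suc total_payoff_0 total_payoff_Suc)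
next
  case (Suc n)
  \<comment> \<open>The recursive equation of \<open>payoff_tilde\<close> matches only an argument
    with two successors.\<close>
  then obtain m where m: "n = Suc m"
    by (cases n) simp_all
  have "payoff_tilde R S T P (Suc n) =
      (payoff_tilde R S T P n + R \<cdot>\<^sub>v ones_vec n) @\<^sub>v
      ((payoff_tilde R S T P n + S \<cdot>\<^sub>v ones_vec n) @\<^sub>v
      ((payoff_tilde R S T P n + T \<cdot>\<^sub>v ones_vec n) @\<^sub>v
       (payoff_tilde R S T P n + P \<cdot>\<^sub>v ones_vec n)))"
    by (simp add: m)
  \<comment> \<open>The histories of one block share their first round, so its payoff is the
    constant handled by \<open>vec_of_list_map_add_const\<close>.\<close>
  also have "\<dots> = vec_of_list (map (total_payoff R S T P (Suc n)) (histories (Suc n)))"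
    by (simp add: Suc.IH histories_Suc total_payoff_Suc vec_of_list_append comp_def
        vec_of_list_map_add_const length_histories del: vec_of_list_map)
  finally show ?case .
qed

theorem lemma2p7:
  fixes R S T P :: real and N :: nat
  assumes "N \<ge> 1"
  shows "payoff_vec R S T P N = (1 / real N) \<cdot>\<^sub>v payoff_tilde R S T P N"
  unfolding payoff_vec_def payoff_tilde_eq_total_payoff[OF assms]
  by (rule eq_vecI) (simp_all add: vec_of_list_index average_payoff_def total_payoff_def)

end
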